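(* Let $(\mathcal{L}_n(x))_{n\ge 0}$ be a Lucas-type polynomial sequence determined by $p_0$, $p_1(x)$, $d(x)=\alpha p_1(x)$ and $g(x)$. Let $q$ be a prime number with $q\equiv 3\pmod 4$. If $g(x)=-q\,h(x)^2$ for some $h(x)\in\mathbb{Z}[x]$, then $\mathcal{L}_q(x)/p_1(x)$ is reducible over $\mathbb{Q}$.
   Context: A Lucas-type polynomial sequence is determined by an integer $p_0$ with $|p_0|\in\{1,2\}$ and non-zero polynomials $p_1(x),g(x)\in\mathbb{Z}[x]$; put $\alpha=2/p_0\in\mathbb{Z}$ and $d(x)=\alpha p_1(x)$. Then $\mathcal{L}_0(x)=p_0$, $\mathcal{L}_1(x)=p_1(x)$, and $\mathcal{L}_n(x)=d(x)\mathcal{L}_{n-1}(x)+g(x)\mathcal{L}_{n-2}(x)$ for $n\ge 2$. Standing assumptions: $\gcd(d(x),g(x))=1$, $\deg(g)<\deg(d)$, $\gcd(p_0,p_1(x))=\gcd(p_0,d(x))=\gcd(p_0,g(x))=1$, and $\deg(p_1)\ge 1$, where $\gcd=1$ means that the only common divisors in $\mathbb{Z}[x]$ are $\pm 1$. "Reducible over $\mathbb{Q}$" means being a product of two non-constant polynomials in $\mathbb{Q}[x]$. *)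

theory Defs
  imports "HOL-Computational_Algebra.Computational_Algebra" "HOL-Number_Theory.Cong"
begin

text \<open>The integer \<open>\<alpha> = 2 / p\<^sub>0\<close>; the division is exact whenever \<open>\<bar>p\<^sub>0\<bar> \<in> {1, 2}\<close>.\<close>

definition lucas_alpha :: "int \<Rightarrow> int" where
  "lucas_alpha p0 = 2 div p0"

definition lucas_d :: "int \<Rightarrow> int poly \<Rightarrow> int poly" where
  "lucas_d p0 p1 = smult (lucas_alpha p0) p1"

fun lucas_poly :: "int \<Rightarrow> int poly \<Rightarrow> int poly \<Rightarrow> nat \<Rightarrow> int poly" where
  "lucas_poly p0 p1 g 0 = [:p0:]"
| "lucas_poly p0 p1 g (Suc 0) = p1"
| "lucas_poly p0 p1 g (Suc (Suc n)) =
     lucas_d p0 p1 * lucas_poly p0 p1 g (Suc n) + g * lucas_poly p0 p1 g n"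

text \<open>Here \<open>coprime\<close> is taken in \<open>\<int>[x]\<close>: every common divisor is a unit, i.e. \<open>\<plusminus>1\<close>.
  In particular it excludes common integer factors of the coefficients.\<close>

definition lucas_type :: "int \<Rightarrow> int poly \<Rightarrow> int poly \<Rightarrow> bool" where
  "lucas_type p0 p1 g \<longleftrightarrow>
     \<bar>p0\<bar> \<in> {1, 2} \<and> p1 \<noteq> 0 \<and> g \<noteq> 0 \<and>
     coprime (lucas_d p0 p1) g \<and> degree g < degree (lucas_d p0 p1) \<and>
     coprime [:p0:] p1 \<and> coprime [:p0:] (lucas_d p0 p1) \<and> coprime [:p0:] g \<and>
     degree p1 \<ge> 1"

text \<open>Not the negation of \<open>irreducible\<close>: constants are neither irreducible nor reducible.\<close>

definition reducible_over_rat :: "int poly \<Rightarrow> bool" where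
  "reducible_over_rat f \<longleftrightarrow>
     (\<exists>u v :: rat poly. map_poly rat_of_int f = u * v \<and> degree u \<ge> 1 \<and> degree v \<ge> 1)"

end

theory Submission
  imports "HOL-Number_Theory.Euler_Criterion" Defs
begin


text \<open>
  With \<open>a + b = d\<close> and \<open>a b = - g = q h\<^sup>2\<close> one has \<open>L\<^sub>q / p\<^sub>1 = (a\<^sup>q + b\<^sup>q) / (a + b)\<close>. Pairing the
  factors \<open>a + \<zeta>\<^sup>2\<^sup>j b\<close> and \<open>a + \<zeta>\<^sup>-\<^sup>2\<^sup>j b\<close> turns this quotient into the product of \<open>d\<^sup>2 - r\<^sub>j\<^sup>2 h\<^sup>2\<close> over
  the quadratic residues \<open>j\<close>, where \<open>r\<^sub>j = \<tau> (\<zeta>\<^sup>j - \<zeta>\<^sup>-\<^sup>j)\<close> and \<open>\<tau>\<close> is the Gauss sum, for which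
  \<open>\<tau>\<^sup>2 = - q\<close>. The power sums of the \<open>r\<^sub>j\<close> over the residues are rational, so by Newton's identities
  the two factors \<open>\<Prod> (d - r\<^sub>j h)\<close> and \<open>\<Prod> (d + r\<^sub>j h)\<close> have rational coefficients.
\<close>

section \<open>Products with rational power sums\<close>

text \<open>Logarithmic differentiation: the factor 1 - r X contributes - r / (1 - r X), a geometric
  series, and these series add up to minus the generating function of the power sums.\<close>

lemma fps_deriv_prod_linear:
  fixes r :: "'b \<Rightarrow> 'a::field"
  assumes "finite A"
  shows "fps_deriv (\<Prod>j\<in>A. 1 - fps_const (r j) * fps_X) =
    - ((\<Prod>j\<in>A. 1 - fps_const (r j) * fps_X) * Abs_fps (\<lambda>m. \<Sum>j\<in>A. r j ^ Suc m))"
  using assms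
proof (induction A rule: finite_induct)
  case empty
  have "Abs_fps (\<lambda>m. 0::'a) = 0" by (simp add: fps_eq_iff)
  then show ?case by simp
next
  case (insert x A)
  let ?P = "\<Prod>j\<in>A. 1 - fps_const (r j) * fps_X"
  let ?L = "1 - fps_const (r x) * fps_X"
  let ?S = "Abs_fps (\<lambda>m. \<Sum>j\<in>A. r j ^ Suc m)"
  let ?G = "Abs_fps (\<lambda>m. r x ^ Suc m)"
  have G: "?L * ?G = fps_const (r x)"
  proof (rule fps_ext)
    fix n show "fps_nth (?L * ?G) n = fps_nth (fps_const (r x)) n"
      by (cases n) (simp_all add: left_diff_distrib mult.assoc)
  qed
  have S: "Abs_fps (\<lambda>m. \<Sum>j\<in>insert x A. r j ^ Suc m) = ?G + ?S"
    using insert by (simp add: fps_eq_iff)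
  have "fps_deriv (?L * ?P) = ?L * fps_deriv ?P - fps_const (r x) * ?P"
    by (simp add: algebra_simps)
  also have "\<dots> = - (?L * ?P * ?S) - (?L * ?G) * ?P"
    by (simp only: insert.IH G) (simp add: algebra_simps)
  also have "\<dots> = - (?L * ?P * (?G + ?S))" by (simp add: algebra_simps)
  finally show ?case using insert S by simp
qed

text \<open>Newton's identities, read off from the logarithmic derivative of the product.\<close>

lemma prod_linear_coeff_Rats:
  fixes r :: "'b \<Rightarrow> 'a::field_char_0"
  assumes "finite A" and "\<And>m. (\<Sum>j\<in>A. r j ^ Suc m) \<in> \<rat>"
  shows "coeff (\<Prod>j\<in>A. [:1, - r j:]) n \<in> \<rat>"
proof -
  let ?P = "\<Prod>j\<in>A. 1 - fps_const (r j) * fps_X"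
  have eq: "fps_of_poly (\<Prod>j\<in>A. [:1, - r j:]) = ?P"
    by (simp add: fps_of_poly_prod fps_of_poly_pCons fps_const_neg[symmetric] del: fps_const_neg)
  have "fps_nth ?P n \<in> \<rat>"
  proof (induction n rule: less_induct)
    case (less n)
    show ?case
    proof (cases n)
      case 0
      have "fps_nth ?P 0 = 1"
        by (simp add: eq[symmetric] poly_0_coeff_0[symmetric] poly_prod)
      then show ?thesis using 0 by simp
    next
      case (Suc m)
      \<comment> \<open>Comparing coefficients of X^m expresses (m + 1) times the next coefficient
        through earlier coefficients and power sums; characteristic 0 permits the division by m +
        1.\<close>
      have "of_nat (Suc m) * fps_nth ?P (Suc m) = fps_nth (fps_deriv ?P) m" by simp
      also have "\<dots> = - (\<Sum>i=0..m. fps_nth ?P i * (\<Sum>j\<in>A. r j ^ Suc (m - i)))"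
        by (simp add: fps_deriv_prod_linear[OF assms(1)] fps_mult_nth del: fps_deriv_nth)
      also have "\<dots> \<in> \<rat>"
        unfolding Rats_minus_iff using less.IH Suc assms(2)
        by (intro Rats_sum[where A = "{0..m}"] Rats_mult) (auto simp del: power_Suc)
      finally have "of_nat (Suc m) * fps_nth ?P (Suc m) / of_nat (Suc m) \<in> \<rat>"
        by (intro Rats_divide) auto
      then show ?thesis using Suc by (simp del: of_nat_Suc)
    qed
  qed
  then show ?thesis by (simp add: eq[symmetric])
qed

text \<open>The monic polynomial with roots \<open>r j\<close> is the reversal of the product of the
  1 - r X, so its coefficients are rational too. It is homogenized so that one list \<open>c\<close>
  serves every y, in particular both h and -h.\<close>

lemma prod_linear_rational_expansion:
  fixes r :: "'b \<Rightarrow> 'a::field_char_0"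
  assumes "finite A" and "\<And>m. (\<Sum>j\<in>A. r j ^ Suc m) \<in> \<rat>"
  obtains c :: "nat \<Rightarrow> rat" where "c (card A) = 1"
    and "\<And>x y. (\<Prod>j\<in>A. x - r j * y) = (\<Sum>k\<le>card A. of_rat (c k) * x ^ k * y ^ (card A - k))"
proof -
  let ?n = "card A"
  define P where "P = (\<Prod>j\<in>A. [:- r j, 1:])"
  have deg: "degree P = ?n"
    unfolding P_def by (subst degree_prod_eq_sum_degree) auto
  have lead: "coeff P ?n = 1"
    using deg lead_coeff_prod[of "\<lambda>j. [:- r j, 1:]" A] by (simp add: P_def)
  have "reflect_poly [:- r j, 1:] = [:1, - r j:]" for j
    by (simp add: reflect_poly_pCons' one_pCons monom_altdef)
  then have refl: "reflect_poly P = (\<Prod>j\<in>A. [:1, - r j:])"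
    unfolding P_def by (simp add: reflect_poly_prod)
  have "coeff P k \<in> \<rat>" for k
  proof (cases "k \<le> ?n")
    case True
    then have "coeff P k = coeff (reflect_poly P) (?n - k)"
      by (simp add: coeff_reflect_poly deg)
    then show ?thesis using prod_linear_coeff_Rats[OF assms] refl by metis
  next
    case False
    then show ?thesis using deg by (simp add: coeff_eq_0)
  qed
  then have "\<forall>k. \<exists>c. coeff P k = of_rat c" by (meson Rats_cases)
  then obtain c where c: "\<And>k. coeff P k = of_rat (c k)" by metis
  have "(\<Prod>j\<in>A. x - r j * y) = (\<Sum>k\<le>?n. of_rat (c k) * x ^ k * y ^ (?n - k))" for x y
  \<comment> \<open>Homogenizing divides by y. At y = 0 only the leading term survives, because 0 ^
    0 = 1.\<close>
  proof (cases "y = 0")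
    case True
    have "(\<Sum>k\<le>?n. of_rat (c k) * x ^ k * y ^ (?n - k)) = (\<Sum>k\<in>{?n}. coeff P k * x ^ k)"
      using True by (intro sum.mono_neutral_cong_right) (auto simp: c)
    then show ?thesis using True lead by simp
  next
    case False
    have "(\<Prod>j\<in>A. x - r j * y) = (\<Prod>j\<in>A. y * (x / y - r j))"
      using False by (intro prod.cong) (auto simp: field_simps)
    also have "\<dots> = y ^ ?n * poly P (x / y)"
      by (simp add: prod.distrib P_def poly_prod)
    also have "\<dots> = (\<Sum>k\<le>?n. of_rat (c k) * x ^ k * y ^ (?n - k))"
      using False unfolding poly_altdef deg sum_distrib_left
      by (intro sum.cong) (auto simp: c power_divide power_diff)
    finally show ?thesis .
  qed
  moreover have "c ?n = 1"
    using lead c[of ?n] by simp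
  ultimately show ?thesis using that by blast
qed

text \<open>The term d^n strictly dominates all others, so there is no cancellation. This will show
  that the two rational factors are not constant.\<close>

lemma degree_homogeneous_sum:
  fixes d h :: "'a::idom poly"
  assumes "degree h < degree d" and "c n = 1"
  shows "degree (\<Sum>k\<le>n. smult (c k) (d ^ k * h ^ (n - k))) = n * degree d"
proof (cases n)
  case 0
  then show ?thesis using assms by simp
next
  case (Suc m)
  have "d \<noteq> 0" using assms by auto
  let ?f = "\<lambda>k. smult (c k) (d ^ k * h ^ (n - k))"
  have "degree (\<Sum>k<n. ?f k) < degree (d ^ n)"
  proof (rule degree_sum_less)
    fix k assume "k \<in> {..<n}"
    then have k: "k < n" by simp
    have "degree (?f k) \<le> degree (d ^ k) + degree (h ^ (n - k))"
      using degree_smult_le degree_mult_le order_trans by blast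
    also have "\<dots> \<le> k * degree d + (n - k) * degree h"
      using \<open>d \<noteq> 0\<close> degree_power_le[of h "n - k"] by (simp add: degree_power_eq mult.commute)
    also have "\<dots> < k * degree d + (n - k) * degree d"
      using k assms(1) by simp
    also have "\<dots> = degree (d ^ n)"
      using k \<open>d \<noteq> 0\<close> by (simp add: degree_power_eq flip: add_mult_distrib)
    finally show "degree (?f k) < degree (d ^ n)" .
  next
    show "0 < degree (d ^ n)" using Suc assms(1) by (simp add: degree_power_eq[OF \<open>d \<noteq> 0\<close>] del: power_Suc)
  qed
  then have "degree ((\<Sum>k<n. ?f k) + d ^ n) = degree (d ^ n)"
    by (rule degree_add_eq_right)
  moreover have "(\<Sum>k\<le>n. ?f k) = (\<Sum>k<n. ?f k) + d ^ n"
    using assms(2) by (simp add: lessThan_Suc_atMost[symmetric])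
  ultimately show ?thesis using \<open>d \<noteq> 0\<close> by (simp add: degree_power_eq)
qed

section \<open>Gauss sums\<close>

definition unity_root :: "nat \<Rightarrow> int \<Rightarrow> complex" where
  "unity_root n k = cis (2 * pi * of_int k / of_nat n)"

lemma unity_root_add: "unity_root n (j + k) = unity_root n j * unity_root n k"
  by (simp add: unity_root_def cis_mult ring_distribs add_divide_distrib)

lemma unity_root_0 [simp]: "unity_root n 0 = 1"
  by (simp add: unity_root_def)

lemma unity_root_minus: "unity_root n (- k) * unity_root n k = 1"
  by (simp flip: unity_root_add)

lemma unity_root_power: "unity_root n k ^ m = unity_root n (int m * k)"
  by (simp add: unity_root_def DeMoivre mult_ac)

lemma unity_root_mod: "n > 0 \<Longrightarrow> unity_root n (k mod int n) = unity_root n k"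
proof -
  assume n: "n > 0"
  have *: "unity_root n (int n * m) = 1" for m
  proof -
    have "unity_root n (int n * m) = cis (2 * pi * of_int m)"
      using n by (simp add: unity_root_def mult.assoc)
    then show ?thesis by (metis Ints_of_int cis_multiple_2pi)
  qed
  have "unity_root n k = unity_root n (k mod int n + int n * (k div int n))" by simp
  also have "\<dots> = unity_root n (k mod int n)" by (simp only: unity_root_add * mult_1_right)
  finally show ?thesis ..
qed

lemma bij_betw_unity_root:
  assumes "n > 0"
  shows "bij_betw (unity_root n) {0..<int n} {z. z ^ n = 1}"
proof -
  have "bij_betw nat {0..<int n} {..<n}"
    by (rule bij_betw_byWitness[where f' = int]) auto
  then have "bij_betw ((\<lambda>k. cis (2 * pi * real k / real n)) \<circ> nat) {0..<int n} {z. z ^ n = 1}"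
    using bij_betw_roots_unity[OF assms] by (rule bij_betw_trans)
  then show ?thesis
    by (rule bij_betw_cong[THEN iffD1, rotated]) (auto simp: unity_root_def)
qed

lemma unity_root_eq_1_iff:
  assumes "n > 0"
  shows "unity_root n k = 1 \<longleftrightarrow> int n dvd k"
proof
  assume "unity_root n k = 1"
  then have "unity_root n (k mod int n) = unity_root n 0"
    using assms by (simp add: unity_root_mod)
  then have "k mod int n = 0"
    using assms bij_betw_imp_inj_on[OF bij_betw_unity_root[OF assms], THEN inj_onD, of "k mod int n" 0]
    by simp
  then show "int n dvd k" by presburger
next
  assume "int n dvd k"
  then have "k mod int n = 0" by presburger
  then show "unity_root n k = 1" using unity_root_mod[OF assms, of k] by simp
qed

lemma sum_unity_root:
  assumes "n > 0"
  shows "(\<Sum>j\<in>{0..<int n}. unity_root n (k * j)) = (if int n dvd k then of_nat n else 0)"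
proof (cases "int n dvd k")
  case True
  then have "unity_root n (k * j) = 1" for j
    using assms by (simp add: unity_root_eq_1_iff)
  then show ?thesis using True by simp
next
  case False
  let ?z = "unity_root n k"
  have z: "?z \<noteq> 1" using False assms by (simp add: unity_root_eq_1_iff)
  have "(\<Sum>j\<in>{0..<int n}. unity_root n (k * j)) = (\<Sum>i<n. ?z ^ i)"
    by (rule sum.reindex_bij_witness[of _ int nat]) (auto simp: unity_root_power mult.commute)
  also have "\<dots> = (?z ^ n - 1) / (?z - 1)" using z by (rule geometric_sum)
  also have "?z ^ n = 1" using assms by (simp add: unity_root_power unity_root_eq_1_iff)
  finally show ?thesis using False by simp
qed

lemma coeff_mult_Ints:
  fixes p r :: "'a::comm_ring_1 poly"
  assumes "\<And>i. coeff p i \<in> \<int>" and "\<And>i. coeff r i \<in> \<int>"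
  shows "coeff (p * r) i \<in> \<int>"
  using assms by (auto simp: coeff_mult intro!: Ints_sum Ints_mult)

lemma coeff_power_Ints:
  fixes p :: "'a::comm_ring_1 poly"
  assumes "\<And>i. coeff p i \<in> \<int>"
  shows "coeff (p ^ m) i \<in> \<int>"
  by (induction m arbitrary: i) (auto intro!: coeff_mult_Ints assms)

text \<open>Each monomial sums to n or 0 over all n-th roots of unity. This replaces a
  Galois-theoretic argument for rationality.\<close>

lemma sum_poly_unity_root_Ints:
  assumes "n > 0" and "\<And>i. coeff p i \<in> \<int>"
  shows "(\<Sum>j\<in>{0..<int n}. poly p (unity_root n j)) \<in> \<int>"
proof -
  have "(\<Sum>j\<in>{0..<int n}. poly p (unity_root n j)) =
      (\<Sum>i\<le>degree p. coeff p i * (\<Sum>j\<in>{0..<int n}. unity_root n (int i * j)))"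
    by (subst sum_distrib_left, subst sum.swap) (simp add: poly_altdef unity_root_power)
  also have "\<dots> \<in> \<int>"
    by (rule Ints_sum, rule Ints_mult[OF assms(2)]) (simp add: sum_unity_root[OF assms(1)])
  finally show ?thesis .
qed

text \<open>Substitute x = - a / b into the factorization of x^n - 1 and clear denominators by (-
  b)^n; oddness turns - (- b)^n into b^n.\<close>

lemma sum_power_plus_power_factor:
  assumes "odd n"
  shows "a ^ n + b ^ n = (\<Prod>j\<in>{0..<int n}. a + unity_root n j * b)"
proof (cases "b = 0")
  case True
  then show ?thesis using assms by (auto simp: zero_power odd_pos)
next
  case False
  have n: "n > 0" using assms by (rule odd_pos)
  define P :: "complex poly" where "P = monom 1 n - 1"
  have root: "poly P z = 0 \<longleftrightarrow> z ^ n = 1" for z by (simp add: P_def poly_monom)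
  have deg: "degree P = n"
    unfolding P_def using n by (subst diff_conv_add_uminus, subst degree_add_eq_left) (auto simp: degree_monom_eq)
  have lead: "lead_coeff P = 1" using n deg by (simp add: P_def)
  \<comment> \<open>The derivative n x^(n-1) vanishes at most at 0, which is not a root of
    \<open>P\<close>.\<close>
  have "rsquarefree P"
    unfolding rsquarefree_roots using n
    by (auto simp: P_def pderiv_diff pderiv_monom poly_monom zero_power)
  then have "P = (\<Prod>z | z ^ n = 1. [:- z, 1:])"
    using complex_poly_decompose_rsquarefree[of P] lead root by simp
  then have "poly P x = (\<Prod>z | z ^ n = 1. x - z)" for x
    by (simp add: poly_prod)
  then have P: "x ^ n - 1 = (\<Prod>j\<in>{0..<int n}. x - unity_root n j)" for x
    by (simp add: P_def poly_monom prod.reindex_bij_betw[OF bij_betw_unity_root[OF n], of "\<lambda>z. x - z"])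
  have "(\<Prod>j\<in>{0..<int n}. a + unity_root n j * b) = (\<Prod>j\<in>{0..<int n}. - b * (- a / b - unity_root n j))"
    using False by (intro prod.cong) (auto simp: field_simps)
  also have "\<dots> = (- b) ^ n * ((- a / b) ^ n - 1)"
    unfolding P by (simp add: prod.distrib del: mult_minus_left)
  also have "\<dots> = a ^ n + b ^ n"
    using False assms by (simp add: field_simps)
  finally show ?thesis ..
qed

lemma bij_betw_mult_mod:
  fixes k p :: int
  assumes "p > 0" and "coprime k p"
  shows "bij_betw (\<lambda>j. k * j mod p) {0..<p} {0..<p}"
proof -
  have inj: "inj_on (\<lambda>j. k * j mod p) {0..<p}"
  proof (rule inj_onI)
    fix x y assume xy: "x \<in> {0..<p}" "y \<in> {0..<p}" "k * x mod p = k * y mod p"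
    then have "[k * x = k * y] (mod p)" by (simp add: cong_def)
    then have "[x = y] (mod p)" using assms by (simp add: cong_mult_lcancel)
    then show "x = y" using xy by (simp add: cong_def)
  qed
  have sub: "(\<lambda>j. k * j mod p) ` {0..<p} \<subseteq> {0..<p}" using assms by auto
  show ?thesis
    unfolding bij_betw_def using inj endo_inj_surj[OF _ sub inj] by simp
qed

text \<open>Stated for an abstract commutative monoid to cover both the sums over Legendre symbols
  and the product of the factors of a^q + b^q.\<close>

lemma (in comm_monoid_set) reindex_mult_mod:
  fixes k p :: int
  assumes "p > 0" and "coprime k p" and "\<And>j. g (j mod p) = g j"
  shows "F (\<lambda>j. g (k * j)) {0..<p} = F g {0..<p}"
  using reindex_bij_betw[OF bij_betw_mult_mod[OF assms(1,2)], of g] assms(3) by simp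

section \<open>The Legendre symbol and the quadratic Gauss sum modulo q\<close>

locale prime_3_mod_4 =
  fixes q :: nat
  assumes prime: "prime q" and mod4: "[q = 3] (mod 4)"
begin

abbreviation "e \<equiv> unity_root q"
abbreviation "\<chi> a \<equiv> Legendre a (int q)"

definition gauss_sum :: "int \<Rightarrow> complex" where
  "gauss_sum k = (\<Sum>j\<in>{0..<int q}. of_int (\<chi> j) * e (k * j))"

lemma q_gt_2: "q > 2" and odd_q: "odd q" and odd_half: "odd ((q - 1) div 2)"
proof -
  have *: "q mod 4 = 3" using mod4 by (simp add: cong_def)
  then show "odd q" by presburger
  then show "q > 2" using prime_gt_1_nat[OF prime] by presburger
  show "odd ((q - 1) div 2)" using * by presburger
qed

lemma q_gt_0: "q > 0" using q_gt_2 by simp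

lemma prime_int: "prime (int q)" using prime by simp

lemma Legendre_mod: "\<chi> (a mod int q) = \<chi> a"
  by (simp add: Legendre_def QuadRes_def cong_def)

text \<open>Two numbers from {-1, 0, 1} differ by at most 2 < q, so the congruences of Euler's
  criterion become equalities.\<close>

lemma Legendre_cong_eq:
  assumes "[\<chi> a = b] (mod int q)" and "b \<in> {-1, 0, 1}"
  shows "\<chi> a = b"
proof -
  have "int q dvd \<chi> a - b" using assms(1) by (simp add: cong_iff_dvd_diff)
  moreover have "\<bar>\<chi> a - b\<bar> < int q" using assms(2) q_gt_2 by (auto simp: Legendre_def)
  ultimately show ?thesis using zdvd_not_zless[of "\<bar>\<chi> a - b\<bar>" "int q"] by auto
qed

lemma Legendre_mult: "\<chi> (a * b) = \<chi> a * \<chi> b"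
proof (rule Legendre_cong_eq)
  note E = euler_criterion[OF prime q_gt_2]
  have "[\<chi> (a * b) = a ^ ((q - 1) div 2) * b ^ ((q - 1) div 2)] (mod int q)"
    using E[of "a * b"] unfolding power_mult_distrib .
  moreover have "[\<chi> a * \<chi> b = a ^ ((q - 1) div 2) * b ^ ((q - 1) div 2)] (mod int q)"
    by (rule cong_mult[OF E E])
  ultimately show "[\<chi> (a * b) = \<chi> a * \<chi> b] (mod int q)"
    using cong_trans cong_sym by blast
qed (auto simp: Legendre_def)

text \<open>For q = 3 modulo 4 the exponent (q - 1) / 2 is odd, so Euler's criterion makes -1 a
  non-residue. The sign of the squared Gauss sum and the pairing of j with q - j both rest on
  this.\<close>

lemma Legendre_minus: "\<chi> (- a) = - \<chi> a"
proof -
  have "\<chi> (- 1) = - 1"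
    using euler_criterion[OF prime q_gt_2, of "- 1"] odd_half by (intro Legendre_cong_eq) auto
  then show ?thesis using Legendre_mult[of "- 1" a] by simp
qed

lemma Legendre_reflect: "\<chi> (int q - a) = - \<chi> a"
  using Legendre_mod[of "int q + - a"] Legendre_mod[of "- a"]
  by (simp only: mod_add_self1) (simp add: Legendre_minus)

lemma Legendre_1: "\<chi> 1 = 1"
  using euler_criterion[OF prime q_gt_2, of 1] by (intro Legendre_cong_eq) auto

lemma Legendre_eq_0_iff: "\<chi> a = 0 \<longleftrightarrow> int q dvd a"
  by (auto simp: Legendre_def cong_0_iff)

lemma Legendre_square: "\<not> int q dvd a \<Longrightarrow> \<chi> a * \<chi> a = 1"
  by (auto simp: Legendre_def cong_0_iff)

lemma coprime_q: "\<not> int q dvd k \<Longrightarrow> coprime k (int q)"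
  using prime_int by (metis coprime_commute prime_imp_coprime)

lemma gauss_sum_eq: "gauss_sum k = of_int (\<chi> k) * gauss_sum 1"
proof (cases "int q dvd k")
  case True
  \<comment> \<open>The symbol is odd, so its complete sum equals its own negative.\<close>
  have "(\<Sum>j\<in>{0..<int q}. \<chi> j) = (\<Sum>j\<in>{0..<int q}. \<chi> (- 1 * j))"
    using q_gt_0 by (intro sum.reindex_mult_mod[symmetric] Legendre_mod) auto
  also have "\<dots> = - (\<Sum>j\<in>{0..<int q}. \<chi> j)" by (simp add: Legendre_minus sum_negf)
  finally have S0: "(\<Sum>j\<in>{0..<int q}. \<chi> j) = 0" by simp
  have "e (k * j) = 1" for j using True q_gt_0 by (simp add: unity_root_eq_1_iff)
  then have "gauss_sum k = of_int (\<Sum>j\<in>{0..<int q}. \<chi> j)"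
    by (simp add: gauss_sum_def)
  then show ?thesis using S0 True Legendre_eq_0_iff[of k] by simp
next
  case False
  let ?f = "\<lambda>j. of_int (\<chi> j) * e j"
  have "gauss_sum 1 = (\<Sum>j\<in>{0..<int q}. ?f (k * j))"
    unfolding gauss_sum_def using q_gt_0 coprime_q[OF False]
    by (subst sum.reindex_mult_mod) (auto simp: Legendre_mod unity_root_mod)
  also have "\<dots> = of_int (\<chi> k) * gauss_sum k"
    by (simp add: gauss_sum_def sum_distrib_left Legendre_mult mult_ac)
  finally have "of_int (\<chi> k) * gauss_sum 1 = of_int (\<chi> k * \<chi> k) * gauss_sum k" by simp
  then show ?thesis using Legendre_square[OF False] by simp
qed

text \<open>One factor is expanded and the other absorbed by \<open>gauss_sum_eq\<close>. After
  exchanging the sums, the inner complete sum vanishes unless k = q - 1, which leaves q times the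
  symbol of -1.\<close>

lemma gauss_sum_square: "gauss_sum 1 ^ 2 = - of_nat q"
proof -
  have *: "(\<Sum>j\<in>{0..<int q}. e ((k + 1) * j)) = (if k = int q - 1 then of_nat q else 0)"
    if "k \<in> {0..<int q}" for k
  proof -
    have "int q dvd k + 1 \<longleftrightarrow> k = int q - 1"
      using that zdvd_imp_le[of "int q" "k + 1"] by auto
    then show ?thesis using sum_unity_root[OF q_gt_0, of "k + 1"] by simp
  qed
  have "gauss_sum 1 ^ 2 = (\<Sum>j\<in>{0..<int q}. gauss_sum j * e j)"
  proof -
    have "gauss_sum 1 ^ 2 = gauss_sum 1 * (\<Sum>j\<in>{0..<int q}. of_int (\<chi> j) * e j)"
      by (simp add: power2_eq_square gauss_sum_def)
    also have "\<dots> = (\<Sum>j\<in>{0..<int q}. of_int (\<chi> j) * gauss_sum 1 * e j)"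
      by (simp add: sum_distrib_left mult_ac)
    finally show ?thesis by (simp only: gauss_sum_eq[symmetric])
  qed
  also have "\<dots> = (\<Sum>j\<in>{0..<int q}. \<Sum>k\<in>{0..<int q}. of_int (\<chi> k) * e ((k + 1) * j))"
  proof -
    have "e (j * k) * e j = e ((k + 1) * j)" for j k
      by (simp add: algebra_simps flip: unity_root_add)
    then show ?thesis by (simp add: gauss_sum_def sum_distrib_right mult.assoc)
  qed
  also have "\<dots> = (\<Sum>k\<in>{0..<int q}. of_int (\<chi> k) * (\<Sum>j\<in>{0..<int q}. e ((k + 1) * j)))"
    by (subst sum.swap) (simp add: sum_distrib_left)
  also have "\<dots> = (\<Sum>k\<in>{0..<int q}. if k = int q - 1 then of_int (\<chi> k) * of_nat q else 0)"
    by (intro sum.cong refl, subst *) auto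
  also have "\<dots> = of_int (\<chi> (int q - 1)) * of_nat q"
    using q_gt_0 by (subst sum.delta) auto
  finally show ?thesis by (simp add: Legendre_reflect Legendre_1)
qed

section \<open>Pairing residues with non-residues, and the rational factorization\<close>

definition quad_residues :: "int set" where
  "quad_residues = {j \<in> {0..<int q}. \<chi> j = 1}"

definition gauss_root :: "int \<Rightarrow> complex" where
  "gauss_root j = gauss_sum 1 * (e j - e (- j))"

text \<open>Reflection j to q - j flips the Legendre symbol, hence exchanges the residues with the
  non-residues.\<close>

lemma quad_residues_partition:
  "{0<..<int q} = quad_residues \<union> (\<lambda>j. int q - j) ` quad_residues"
  "quad_residues \<inter> (\<lambda>j. int q - j) ` quad_residues = {}"
proof -
  show "quad_residues \<inter> (\<lambda>j. int q - j) ` quad_residues = {}"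
    by (auto simp: quad_residues_def Legendre_reflect)
  have nz: "0 < j" if "j \<in> quad_residues" for j
    using that Legendre_eq_0_iff[of j] by (cases "j = 0") (auto simp: quad_residues_def)
  show "{0<..<int q} = quad_residues \<union> (\<lambda>j. int q - j) ` quad_residues"
  proof (intro equalityI subsetI)
    fix j assume j: "j \<in> {0<..<int q}"
    then have "\<chi> j \<noteq> 0" using Legendre_eq_0_iff[of j] zdvd_imp_le[of "int q" j] by auto
    then have "\<chi> j = 1 \<or> \<chi> (int q - j) = 1" unfolding Legendre_reflect by (auto simp: Legendre_def split: if_splits)
    moreover have "j = int q - (int q - j)" by simp
    ultimately show "j \<in> quad_residues \<union> (\<lambda>j. int q - j) ` quad_residues"
      using j unfolding quad_residues_def by (elim disjE) (auto intro!: image_eqI[of j _ "int q - j"])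
  next
    fix j assume "j \<in> quad_residues \<union> (\<lambda>j. int q - j) ` quad_residues"
    then show "j \<in> {0<..<int q}" using nz by (auto simp: quad_residues_def)
  qed
qed

lemma finite_quad_residues: "finite quad_residues"
  by (rule finite_subset[of _ "{0..<int q}"]) (auto simp: quad_residues_def)

lemma card_quad_residues_pos: "card quad_residues > 0"
proof -
  have "1 \<in> quad_residues" using q_gt_2 Legendre_1 by (simp add: quad_residues_def)
  then show ?thesis using finite_quad_residues by (auto simp: card_gt_0_iff)
qed

lemma sum_quad_residues:
  fixes f :: "int \<Rightarrow> 'a::comm_monoid_add"
  assumes "f 0 = 0"
  shows "(\<Sum>j\<in>{0..<int q}. f j) = (\<Sum>j\<in>quad_residues. f j + f (int q - j))"
proof -
  have "{0..<int q} = insert 0 {0<..<int q}" using q_gt_0 by auto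
  then have "(\<Sum>j\<in>{0..<int q}. f j) = (\<Sum>j\<in>{0<..<int q}. f j)"
    by (simp only:) (simp add: assms)
  also have "\<dots> = (\<Sum>j\<in>quad_residues. f j + f (int q - j))"
    unfolding quad_residues_partition(1) sum.distrib
    by (subst sum.union_disjoint[OF finite_quad_residues _ quad_residues_partition(2)])
      (simp_all add: finite_quad_residues sum.reindex inj_on_def)
  finally show ?thesis .
qed

text \<open>Index 0 has no partner. Its factor will be a + b, which accounts for the divisor
  \<open>p1\<close> of the Lucas polynomial.\<close>

lemma prod_quad_residues:
  fixes f :: "int \<Rightarrow> 'a::comm_monoid_mult"
  shows "(\<Prod>j\<in>{0..<int q}. f j) = f 0 * (\<Prod>j\<in>quad_residues. f j * f (int q - j))"
proof -
  have "{0..<int q} = insert 0 {0<..<int q}" using q_gt_0 by auto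
  then have "(\<Prod>j\<in>{0..<int q}. f j) = f 0 * (\<Prod>j\<in>{0<..<int q}. f j)" by (simp only:) simp
  also have "(\<Prod>j\<in>{0<..<int q}. f j) = (\<Prod>j\<in>quad_residues. f j * f (int q - j))"
    unfolding quad_residues_partition(1) prod.distrib
    by (subst prod.union_disjoint[OF finite_quad_residues _ quad_residues_partition(2)])
      (simp_all add: finite_quad_residues prod.reindex inj_on_def)
  finally show ?thesis .
qed

text \<open>Multiplied by \<open>\<chi> j\<close>, the numbers \<open>gauss_root j\<close> become even in \<open>j\<close> and integer
  polynomials in \<open>e j\<close>, so the sum over the residues is half of a complete sum.\<close>

lemma sum_gauss_root_power_Rats: "(\<Sum>j\<in>quad_residues. gauss_root j ^ Suc m) \<in> \<rat>"
proof -
  define f where "f j = of_int (\<chi> j) * gauss_root j" for j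
  \<comment> \<open>The symbol of j times \<open>gauss_sum 1\<close> is \<open>gauss_sum j\<close>,
    a polynomial in \<open>e j\<close>; the exponent q - 1 encodes the inverse of
    \<open>e j\<close>.\<close>
  define P :: "complex poly" where "P =
    (\<Sum>k\<in>{0..<int q}. monom (of_int (\<chi> k)) (nat k)) * (monom 1 1 - monom 1 (q - 1))"
  have e_minus: "e (- j) = e j ^ (q - 1)" for j
  proof -
    have "int (q - 1) * j = - j + int q * j" using q_gt_0 by (simp add: of_nat_diff algebra_simps)
    then have "(int (q - 1) * j) mod int q = (- j) mod int q" by (simp only: mod_mult_self2)
    then show ?thesis using unity_root_mod[OF q_gt_0] by (metis unity_root_power)
  qed
  have f: "f j = poly P (e j)" for j
  proof -
    have "poly (\<Sum>k\<in>{0..<int q}. monom (of_int (\<chi> k)) (nat k)) (e j) = gauss_sum j"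
      unfolding gauss_sum_def poly_sum
      by (intro sum.cong) (auto simp: poly_monom unity_root_power mult.commute)
    moreover have "f j = gauss_sum j * (e j - e (- j))"
      by (simp add: f_def gauss_root_def gauss_sum_eq[of j])
    ultimately show ?thesis by (simp add: P_def poly_monom e_minus)
  qed
  have f_refl: "f (int q - j) = f j" for j
  proof -
    have "e (int q - j) = e (- j)"
      using unity_root_mod[OF q_gt_0, of "int q + - j"] unity_root_mod[OF q_gt_0, of "- j"]
      by (simp only: mod_add_self1) simp
    moreover have "e (- (int q - j)) = e j"
      using unity_root_mod[OF q_gt_0, of "j - int q"] unity_root_mod[OF q_gt_0, of j]
      by (simp only: minus_mod_self2 minus_diff_eq)
    ultimately show ?thesis by (simp add: f_def gauss_root_def Legendre_reflect algebra_simps)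
  qed
  have "f 0 = 0" by (simp add: f_def gauss_root_def)
  then have "2 * (\<Sum>j\<in>quad_residues. f j ^ Suc m) = (\<Sum>j\<in>{0..<int q}. f j ^ Suc m)"
    using sum_quad_residues[of "\<lambda>j. f j ^ Suc m"]
    by (simp add: f_refl sum_distrib_left)
  also have "\<dots> = (\<Sum>j\<in>{0..<int q}. poly (P ^ Suc m) (e j))"
    by (simp add: f)
  also have "\<dots> \<in> \<int>"
    unfolding P_def
    by (intro sum_poly_unity_root_Ints q_gt_0 coeff_power_Ints coeff_mult_Ints)
      (auto simp: coeff_sum intro!: Ints_sum)
  finally have "2 * (\<Sum>j\<in>quad_residues. f j ^ Suc m) \<in> \<rat>"
    using Ints_subset_Rats by blast
  then have "2 * (\<Sum>j\<in>quad_residues. f j ^ Suc m) / 2 \<in> \<rat>"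
    by (rule Rats_divide) simp
  \<comment> \<open>On the residues the symbol is 1, so the twist disappears.\<close>
  moreover have "(\<Sum>j\<in>quad_residues. f j ^ Suc m) = (\<Sum>j\<in>quad_residues. gauss_root j ^ Suc m)"
    by (intro sum.cong) (auto simp: f_def quad_residues_def)
  ultimately show ?thesis by simp
qed

text \<open>Doubling the index permutes the classes modulo the odd q and makes each root of unity a
  visible square, so that each pair of factors becomes a difference of squares. Writing the second
  factor with - y lets the same expansion apply to both products.\<close>

lemma sum_power_prod_gauss_root:
  assumes "a * b = of_nat q * y ^ 2"
  shows "a ^ q + b ^ q = (a + b) *
    ((\<Prod>j\<in>quad_residues. (a + b) - gauss_root j * y) * (\<Prod>j\<in>quad_residues. (a + b) - gauss_root j * (- y)))"
proof -
  have pair: "(a + e (2 * j) * b) * (a + e (2 * (int q - j)) * b) =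
      ((a + b) - gauss_root j * y) * ((a + b) - gauss_root j * (- y))" for j
  proof -
    let ?E = "e j" and ?F = "e (- j)"
    have EF: "?E * ?F = 1" using unity_root_minus[of q j] by (simp only: mult.commute)
    have 1: "e (2 * j) = ?E ^ 2" by (simp add: unity_root_power)
    have "(2 * (int q - j)) mod int q = (2 * - j) mod int q"
      by (simp add: algebra_simps mod_diff_left_eq[symmetric, of "int q * 2"])
    then have 2: "e (2 * (int q - j)) = ?F ^ 2"
      using unity_root_mod[OF q_gt_0] by (metis unity_root_power of_nat_numeral)
    have "(a + ?E ^ 2 * b) * (a + ?F ^ 2 * b) =
        a ^ 2 + (?E * ?F) ^ 2 * b ^ 2 + (?E ^ 2 + ?F ^ 2) * (a * b)"
      by (simp add: power2_eq_square algebra_simps)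
    \<comment> \<open>As E F = 1, E^2 + F^2 = (E - F)^2 + 2, and the 2 completes the square.\<close>
    also have "\<dots> = (a + b) ^ 2 + (?E - ?F) ^ 2 * (a * b)"
      by (simp add: power2_diff power2_sum EF mult.assoc) (simp add: algebra_simps)
    also have "\<dots> = (a + b) ^ 2 - gauss_sum 1 ^ 2 * (?E - ?F) ^ 2 * y ^ 2"
      by (simp add: assms gauss_sum_square)
    also have "\<dots> = ((a + b) - gauss_root j * y) * ((a + b) - gauss_root j * (- y))"
      unfolding gauss_root_def by (simp add: power2_eq_square algebra_simps)
    finally show ?thesis unfolding 1 2 .
  qed
  have "coprime 2 (int q)" using odd_q by simp
  then have "a ^ q + b ^ q = (\<Prod>j\<in>{0..<int q}. a + e (2 * j) * b)"
    unfolding sum_power_plus_power_factor[OF odd_q] using q_gt_0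
    by (intro prod.reindex_mult_mod[symmetric]) (auto simp: unity_root_mod)
  also have "\<dots> = (a + b) * (\<Prod>j\<in>quad_residues. (a + e (2 * j) * b) * (a + e (2 * (int q - j)) * b))"
    by (subst prod_quad_residues) simp
  finally show ?thesis unfolding pair prod.distrib .
qed

text \<open>The coefficients are chosen before a, b and y, so evaluations at different points can be
  assembled into polynomials.\<close>

lemma sum_power_rational_factors:
  obtains n and c :: "nat \<Rightarrow> rat" where "n > 0" and "c n = 1"
    and "\<And>a b y :: complex. a * b = of_nat q * y ^ 2 \<Longrightarrow> a ^ q + b ^ q = (a + b) *
      ((\<Sum>k\<le>n. of_rat (c k) * (a + b) ^ k * y ^ (n - k)) *
       (\<Sum>k\<le>n. of_rat (c k) * (a + b) ^ k * (- y) ^ (n - k)))"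
proof -
  obtain c :: "nat \<Rightarrow> rat" where c: "c (card quad_residues) = 1"
    "\<And>x y. (\<Prod>j\<in>quad_residues. x - gauss_root j * y) =
      (\<Sum>k\<le>card quad_residues. of_rat (c k) * x ^ k * y ^ (card quad_residues - k))"
    using prod_linear_rational_expansion[OF finite_quad_residues sum_gauss_root_power_Rats] by metis
  show ?thesis
  proof (rule that[of "card quad_residues" c])
    fix a b y :: complex
    assume "a * b = of_nat q * y ^ 2"
    from sum_power_prod_gauss_root[OF this]
    show "a ^ q + b ^ q = (a + b) *
      ((\<Sum>k\<le>card quad_residues. of_rat (c k) * (a + b) ^ k * y ^ (card quad_residues - k)) *
       (\<Sum>k\<le>card quad_residues. of_rat (c k) * (a + b) ^ k * (- y) ^ (card quad_residues - k)))"
      unfolding c(2) .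
  qed (use c card_quad_residues_pos in auto)
qed

end

section \<open>Lucas-type polynomials\<close>

lemma poly_map_poly_of_int:
  "poly (map_poly of_int p) (of_int x) = (of_int (poly p x) :: 'a::comm_ring_1)"
  by (induction p) (simp_all add: map_poly_pCons)

text \<open>Working at integer points allows a and b to be complex numbers instead of elements of an
  extension of a function field.\<close>

lemma poly_eqI_of_int:
  fixes p r :: "'a::{idom, ring_char_0} poly"
  assumes "\<And>x :: int. poly p (of_int x) = poly r (of_int x)"
  shows "p = r"
proof (rule ccontr)
  assume "p \<noteq> r"
  then have "finite {x. poly (p - r) x = 0}" by (intro poly_roots_finite) simp
  moreover have "range of_int \<subseteq> {x. poly (p - r) x = 0}" using assms by auto
  moreover have "infinite (range (of_int :: int \<Rightarrow> 'a))"
    by (simp add: finite_image_iff inj_on_def)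
  ultimately show False using finite_subset by blast
qed

lemma dvd_lucas_poly_odd: "p1 dvd lucas_poly p0 p1 g (Suc (2 * n))"
  by (induction n) (simp_all add: lucas_d_def dvd_smult)

text \<open>A Binet formula, doubled to avoid dividing \<open>p0\<close> by 2.\<close>

lemma poly_lucas_poly:
  fixes a b :: "'a::comm_ring_1"
  assumes "p0 * lucas_alpha p0 = 2"
    and "a + b = of_int (poly (lucas_d p0 p1) x)" and "a * b = - of_int (poly g x)"
  shows "2 * of_int (poly (lucas_poly p0 p1 g n) x) = of_int p0 * (a ^ n + b ^ n)"
proof (induction n rule: induct_nat_012)
  case 0
  then show ?case by simp
next
  case 1
  have "2 * poly p1 x = p0 * poly (lucas_d p0 p1) x"
    by (simp add: lucas_d_def flip: assms(1))
  then have "of_int (2 * poly p1 x) = of_int p0 * (a + b)"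
    by (simp add: assms(2))
  then show ?case by simp
next
  case (ge2 n)
  have "2 * of_int (poly (lucas_poly p0 p1 g (Suc (Suc n))) x) =
      (a + b) * (2 * of_int (poly (lucas_poly p0 p1 g (Suc n)) x))
      - a * b * (2 * of_int (poly (lucas_poly p0 p1 g n) x))"
    by (simp add: assms(2,3) algebra_simps)
  also have "\<dots> = of_int p0 * (a ^ Suc (Suc n) + b ^ Suc (Suc n))"
    unfolding ge2 by (simp add: algebra_simps)
  finally show ?case .
qed

theorem proposition4p12:
  fixes p0 :: int and p1 g h :: "int poly" and q :: nat
  assumes "lucas_type p0 p1 g"
    and "prime q" and "[q = 3] (mod 4)"
    and "g = - smult (int q) (h ^ 2)"
  shows "p1 dvd lucas_poly p0 p1 g q \<and>
         reducible_over_rat (lucas_poly p0 p1 g q div p1)"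
proof -
  interpret prime_3_mod_4 q by unfold_locales (fact assms)+
  let ?L = "lucas_poly p0 p1 g q" and ?d = "lucas_d p0 p1"
  let ?map = "map_poly rat_of_int"
  have alpha: "p0 * lucas_alpha p0 = 2" and p1: "p1 \<noteq> 0" "degree p1 \<ge> 1"
    and deg: "degree g < degree ?d"
    using assms(1) by (auto simp: lucas_type_def lucas_alpha_def abs_eq_iff')
  have deg_d: "degree (?map ?d) = degree ?d" and deg_h: "degree (?map h) = degree h"
    by (auto intro: degree_map_poly)
  have "degree g = 2 * degree h"
    using q_gt_0 assms(4) by (cases "h = 0") (auto simp: degree_power_eq)
  then have hd: "degree (?map h) < degree (?map ?d)" "degree (- ?map h) < degree (?map ?d)"
    using deg deg_d deg_h by auto
  have "p1 dvd lucas_poly p0 p1 g (Suc (2 * (q div 2)))"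
    by (rule dvd_lucas_poly_odd)
  then have dvd: "p1 dvd ?L" using odd_q by simp
  then obtain M where M: "?L = p1 * M" by (rule dvdE)

  obtain n and c :: "nat \<Rightarrow> rat" where n: "n > 0" and cn: "c n = 1"
    and fac: "\<And>a b y :: complex. a * b = of_nat q * y ^ 2 \<Longrightarrow> a ^ q + b ^ q = (a + b) *
      ((\<Sum>k\<le>n. of_rat (c k) * (a + b) ^ k * y ^ (n - k)) *
       (\<Sum>k\<le>n. of_rat (c k) * (a + b) ^ k * (- y) ^ (n - k)))"
    by (rule sum_power_rational_factors) (rule that)
  \<comment> \<open>\<open>F\<close> at h and at -h will be the two rational factors of the
    quotient.\<close>
  define F where "F y = (\<Sum>k\<le>n. smult (c k) (?map ?d ^ k * y ^ (n - k)))" for y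
  have poly_F: "of_rat (poly (F y) (of_int x)) =
      (\<Sum>k\<le>n. of_rat (c k) * of_int (poly ?d x) ^ k * of_rat (poly y (of_int x)) ^ (n - k) :: complex)"
    for x y
    by (simp add: F_def poly_sum of_rat_sum of_rat_mult of_rat_power poly_map_poly_of_int mult.assoc)

  have "?map p1 * ?map M = ?map p1 * (F (?map h) * F (- ?map h))"
  proof (rule poly_eqI_of_int)
    fix x :: int
    let ?D = "of_int (poly ?d x) :: complex" and ?H = "of_int (poly h x) :: complex"
      and ?G = "of_int (poly g x) :: complex"
    \<comment> \<open>a and b are the roots of t^2 - D t - G, with D and G the values of d and g at
      x.\<close>
    define s where "s = csqrt (?D ^ 2 + 4 * ?G)"
    define a b where "a = (?D + s) / 2" and "b = (?D - s) / 2"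
    have s2: "s ^ 2 = ?D ^ 2 + 4 * ?G" by (simp add: s_def)
    have add: "a + b = ?D" by (simp add: a_def b_def field_simps)
    have "a * b = (?D ^ 2 - s ^ 2) / 4" by (simp add: a_def b_def power2_eq_square field_simps)
    then have mult: "a * b = - ?G" by (simp add: s2)
    then have "a * b = of_nat q * ?H ^ 2" by (simp add: assms(4))
    from fac[OF this] have "a ^ q + b ^ q = ?D * of_rat (poly (F (?map h) * F (- ?map h)) (of_int x))"
      by (simp add: poly_F of_rat_mult of_rat_minus poly_map_poly_of_int add)
    then have "2 * of_int (poly ?L x) =
        of_int p0 * (?D * of_rat (poly (F (?map h) * F (- ?map h)) (of_int x)))"
      using poly_lucas_poly[OF alpha add mult, of q] by simp
    \<comment> \<open>Since d is \<open>lucas_alpha p0\<close> times \<open>p1\<close>, the constant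
      p0 * alpha = 2 cancels the doubling.\<close>
    also have "\<dots> = of_int (p0 * lucas_alpha p0) *
        (of_int (poly p1 x) * of_rat (poly (F (?map h) * F (- ?map h)) (of_int x)))"
      by (simp add: lucas_d_def)
    finally have "complex_of_int (poly ?L x) =
        of_int (poly p1 x) * of_rat (poly (F (?map h) * F (- ?map h)) (of_int x))"
      unfolding alpha by simp
    then have "(of_rat (of_int (poly ?L x)) :: complex) =
        of_rat (of_int (poly p1 x) * poly (F (?map h) * F (- ?map h)) (of_int x))"
      by (simp only: of_rat_mult of_rat_of_int_eq)
    then have "of_int (poly ?L x) = of_int (poly p1 x) * poly (F (?map h) * F (- ?map h)) (of_int x)"
      by (simp only: of_rat_eq_iff)
    then show "poly (?map p1 * ?map M) (of_int x) =
        poly (?map p1 * (F (?map h) * F (- ?map h))) (of_int x)"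
      by (simp add: M poly_map_poly_of_int)
  qed
  moreover have "?map p1 \<noteq> 0"
    using p1 degree_map_poly[of rat_of_int p1] by auto
  ultimately have "?map M = F (?map h) * F (- ?map h)" by simp
  \<comment> \<open>Both degrees equal n times the degree of d, which is positive.\<close>
  moreover have "degree (F (?map h)) \<ge> 1" "degree (F (- ?map h)) \<ge> 1"
    using n hd degree_homogeneous_sum[where c = c and n = n, OF hd(1) cn]
      degree_homogeneous_sum[where c = c and n = n, OF hd(2) cn]
    by (simp_all add: F_def Suc_le_eq)
  moreover have "?L div p1 = M" using M p1 by simp
  ultimately show ?thesis using dvd unfolding reducible_over_rat_def by blast
qed

end
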